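(* For every BCK-algebra or BCI-algebra $(X,*,0)$ there exists a fuzzy BCK/BCI-norm $\|\cdot\|_f:X\times(0,\infty)\to[0,1]$ on $X$.
   Context: A BCI-algebra is a set $X$ with a binary operation $*$ and a distinguished element $0$ such that for all $a,b,c\in X$: (I1) $((a*b)*(a*c))*(c*b)=0$; (I2) $(a*(a*b))*b=0$; (I3) $a*a=0$; (I4) $a*b=0$ and $b*a=0$ imply $a=b$. A BCK-algebra is a BCI-algebra that also satisfies (K): $0*a=0$ for all $a\in X$. For a BCK-algebra or BCI-algebra $(X,*,0)$, a fuzzy BCK/BCI-norm on $X$ is a mapping $\|\cdot\|_f : X\times(0,\infty)\to[0,1]$, with values written $\|(x,t)\|_f$, satisfying for all $x,y,z\in X$ and $s,t\in(0,\infty)$: (FN1) $\|(x,t)\|_f=1$ if and only if $x=0$; (FN2) if $t\ge s$ then $\|(x,t)\|_f\ge\|(x,s)\|_f$; (FN3) $\lim_{t\to\infty}\|(x,t)\|_f=1$; (FN4) $\|(x*z,s+t)\|_f\ge\min\{\|(x*y,s)\|_f,\|(y*z,t)\|_f\}$. *)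

theory Defs
  imports Complex_Main "HOL-Library.FuncSet"
begin

locale bci_algebra =
  fixes X :: "'a set"
    and star :: "'a \<Rightarrow> 'a \<Rightarrow> 'a" (infixl "\<star>" 70)
    and e :: 'a
  assumes star_closed: "\<lbrakk>a \<in> X; b \<in> X\<rbrakk> \<Longrightarrow> a \<star> b \<in> X"
    and zero_closed: "e \<in> X"
    and I1: "\<lbrakk>a \<in> X; b \<in> X; c \<in> X\<rbrakk> \<Longrightarrow> ((a \<star> b) \<star> (a \<star> c)) \<star> (c \<star> b) = e"
    and I2: "\<lbrakk>a \<in> X; b \<in> X\<rbrakk> \<Longrightarrow> (a \<star> (a \<star> b)) \<star> b = e"
    and I3: "a \<in> X \<Longrightarrow> a \<star> a = e"
    and I4: "\<lbrakk>a \<in> X; b \<in> X; a \<star> b = e; b \<star> a = e\<rbrakk> \<Longrightarrow> a = b"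

locale bck_algebra = bci_algebra +
  assumes K: "a \<in> X \<Longrightarrow> e \<star> a = e"

(* Only the values of N on X \<times> (0,\<infinity>) are constrained; the norm axioms are
   stated separately from the algebra axioms, so that one notion serves both
   BCK- and BCI-algebras.  In FN1 the parameter t is universally quantified
   outside the equivalence. *)
locale fuzzy_bck_bci_norm =
  fixes X :: "'a set"
    and star :: "'a \<Rightarrow> 'a \<Rightarrow> 'a" (infixl "\<star>" 70)
    and e :: 'a
    and N :: "'a \<times> real \<Rightarrow> real"
  assumes maps_to: "N \<in> X \<times> {0<..} \<rightarrow> {0..1}"
    and FN1: "\<lbrakk>x \<in> X; 0 < t\<rbrakk> \<Longrightarrow> N (x, t) = 1 \<longleftrightarrow> x = e"
    and FN2: "\<lbrakk>x \<in> X; 0 < s; 0 < t; s \<le> t\<rbrakk> \<Longrightarrow> N (x, t) \<ge> N (x, s)"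
    and FN3: "x \<in> X \<Longrightarrow> ((\<lambda>t. N (x, t)) \<longlongrightarrow> 1) at_top"
    and FN4: "\<lbrakk>x \<in> X; y \<in> X; z \<in> X; 0 < s; 0 < t\<rbrakk>
      \<Longrightarrow> N (x \<star> z, s + t) \<ge> min (N (x \<star> y, s)) (N (y \<star> z, t))"

end

theory Submission
  imports Defs
begin

text \<open>
  The relation \<open>x \<star> y = e\<close> is transitive, so the function equal to \<open>1\<close> at \<open>e\<close> and to
  \<open>t / (t + 1)\<close> at every other point is a norm: in (FN4), if \<open>x \<star> z \<noteq> e\<close>, then one of
  \<open>x \<star> y\<close>, \<open>y \<star> z\<close> differs from \<open>e\<close>, and \<open>t / (t + 1)\<close> increases with \<open>t\<close>.
\<close>

context bci_algebra
begin

text \<open>Taking both arguments of (I2) to be \<open>a\<close> yields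
  \<open>(a \<star> e) \<star> a = e\<close>, which the hypothesis turns into
  \<open>e \<star> a = e\<close>; antisymmetry (I4) finishes.\<close>

lemma star_zero_eq_zeroD:
  assumes "a \<in> X" "a \<star> e = e"
  shows "a = e"
proof -
  have "e \<star> a = e"
    using I2[OF \<open>a \<in> X\<close> \<open>a \<in> X\<close>] I3[OF \<open>a \<in> X\<close>] assms(2) by simp
  then show ?thesis
    using I4 assms zero_closed by blast
qed

lemma star_eq_zero_trans:
  assumes "x \<in> X" "y \<in> X" "z \<in> X" "x \<star> y = e" "y \<star> z = e"
  shows "x \<star> z = e"
proof -
  \<comment> \<open>In this instance of (I1) the hypotheses replace \<open>x \<star> y\<close> and
    \<open>y \<star> z\<close> by \<open>e\<close>; the previous lemma then strips the two trailing
    \<open>e\<close> one after the other.\<close>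
  have "((x \<star> z) \<star> e) \<star> e = e"
    using I1[of x z y] assms by simp
  then show ?thesis
    using star_zero_eq_zeroD star_closed zero_closed assms by metis
qed

lemma fuzzy_norm_exists: "\<exists>N. fuzzy_bck_bci_norm X star e N"
proof -
  define N :: "'a \<times> real \<Rightarrow> real"
    where "N = (\<lambda>(x, t). if x = e then 1 else t / (t + 1))"
  have mono: "s / (s + 1) \<le> t / (t + 1)" if "0 < s" "s \<le> t" for s t :: real
    using that by (simp add: field_simps)
  have N_le: "N (x, t) \<le> 1" if "0 < t" for x t
    using that by (simp add: N_def)
  have "fuzzy_bck_bci_norm X star e N"
  proof
    show "N \<in> X \<times> {0<..} \<rightarrow> {0..1}"
      by (auto simp: N_def)
    show "N (x, t) = 1 \<longleftrightarrow> x = e" if "x \<in> X" "0 < t" for x t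
      using that by (auto simp: N_def field_simps)
    show "N (x, t) \<ge> N (x, s)" if "x \<in> X" "0 < s" "0 < t" "s \<le> t" for x s t
      using mono that by (simp add: N_def)
    show "((\<lambda>t. N (x, t)) \<longlongrightarrow> 1) at_top" if "x \<in> X" for x
    proof (cases "x = e")
      case True
      then show ?thesis by (simp add: N_def)
    next
      case False
      have "((\<lambda>t::real. 1 - inverse (1 + t)) \<longlongrightarrow> 1 - 0) at_top"
        by (intro tendsto_intros tendsto_inverse_0_at_top
            filterlim_tendsto_add_at_top[OF tendsto_const] filterlim_ident)
      \<comment> \<open>The two expressions differ at \<open>t = -1\<close>, where division by zero
        gives \<open>1\<close> and \<open>0\<close>, so they are compared only for
        \<open>t > 0\<close>.\<close>
      moreover have "\<forall>\<^sub>F t in at_top. 1 - inverse (1 + t) = N (x, t)"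
        using eventually_gt_at_top[of 0]
        by eventually_elim (use False in \<open>simp add: N_def field_simps\<close>)
      ultimately show ?thesis
        using Lim_transform_eventually by fastforce
    qed
    show "N (x \<star> z, s + t) \<ge> min (N (x \<star> y, s)) (N (y \<star> z, t))"
      if "x \<in> X" "y \<in> X" "z \<in> X" "0 < s" "0 < t" for x y z s t
    proof (cases "x \<star> z = e")
      case True
      \<comment> \<open>The left side is \<open>1\<close>, so bounding one argument of
        \<open>min\<close> by \<open>1\<close> suffices.\<close>
      then show ?thesis
        using N_le[OF \<open>0 < s\<close>, of "x \<star> y"] by (simp add: N_def min_le_iff_disj)
    next
      case False
      then have "x \<star> y \<noteq> e \<or> y \<star> z \<noteq> e"
        using star_eq_zero_trans that by blast
      then show ?thesis
        using False mono[of s "s + t"] mono[of t "s + t"] that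
        by (auto simp: N_def min_le_iff_disj)
    qed
  qed
  then show ?thesis by (rule exI[of _ N])
qed

end

theorem theorem3p16:
  fixes X :: "'a set" and star :: "'a \<Rightarrow> 'a \<Rightarrow> 'a" and e :: 'a
  assumes "bck_algebra X star e \<or> bci_algebra X star e"
  shows "\<exists>N :: 'a \<times> real \<Rightarrow> real. fuzzy_bck_bci_norm X star e N"
  using assms by (elim disjE) (rule bci_algebra.fuzzy_norm_exists, erule bck_algebra.axioms(1), rule bci_algebra.fuzzy_norm_exists)

end
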